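(* Let $p,q\in\mathbb{R}$ with $q<p$ and let $Q\in\mathcal{S}_o^n$. If $K,L\in\mathcal{K}_o^n$ and $$\widetilde{C}_{p,q}(K,Q,\cdot)=\widetilde{C}_{p,q}(L,Q,\cdot)$$ as Borel measures on $S^{n-1}$, then $K=L$.
   Context: $S^{n-1}$ is the unit sphere of $\mathbb{R}^n$ and $du$ is spherical Lebesgue measure. $\mathcal{K}_o^n$ is the set of convex bodies (compact convex sets with non-empty interior) in $\mathbb{R}^n$ containing the origin in their interiors. $\mathcal{S}_o^n$ is the set of star bodies (compact sets, star-shaped with respect to the origin, with continuous radial function) in $\mathbb{R}^n$ containing the origin in their interiors. The radial function is $\rho_Q(u)=\max\{\lambda\ge 0:\lambda u\in Q\}$, $u\in S^{n-1}$, and the support function is $h_K(v)=\max\{v\cdot x:x\in K\}$. For $K\in\mathcal{K}_o^n$ and a Borel set $\eta\subseteq S^{n-1}$, $\boldsymbol{\alpha}^*_K(\eta)$ is the set of $u\in S^{n-1}$ such that some $v\in\eta$ is an outer unit normal of $K$ at the boundary point $\rho_K(u)u$, i.e. $\rho_K(u)u\cdot v=h_K(v)$. For $q\in\mathbb{R}$, the $q$-th dual curvature measure is $$\widetilde{C}_q(K,Q,\eta)=\frac1n\int_{\boldsymbol{\alpha}^*_K(\eta)}\rho_K^q(u)\rho_Q^{n-q}(u)\,du,$$ and for $p,q\in\mathbb{R}$ the $L_p$ dual curvature measure is the Borel measure on $S^{n-1}$ given by $d\widetilde{C}_{p,q}(K,Q,\cdot)=h_K^{-p}\,d\widetilde{C}_q(K,Q,\cdot)$.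 *)

theory Defs
  imports "HOL-Analysis.Analysis"
begin

subsection \<open>Spherical Lebesgue measure\<close>

text \<open>
  The spherical measure is obtained from polar coordinates: \<open>\<eta>\<close> gets \<open>n\<close> times the volume of
  the cone \<open>{t u | 0 < t < 1, u \<in> \<eta>}\<close>, i.e. the usual surface area (total mass
  \<open>n * vol(ball 0 1)\<close>, counting measure on \<open>{-1, 1}\<close> if \<open>n = 1\<close>). The completion is needed since
  the reverse radial Gauss image of a Borel set is spherically Lebesgue measurable, but need not
  be Borel.
\<close>

definition sphere_lborel :: "'a::euclidean_space measure" where
  "sphere_lborel = scale_measure (of_nat DIM('a))
     (distr (restrict_space lborel (ball 0 1 - {0})) (restrict_space borel (sphere 0 1)) sgn)"

definition sphere_lebesgue :: "'a::euclidean_space measure" where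
  "sphere_lebesgue = completion sphere_lborel"

lemma emeasure_sphere_lebesgue:
  fixes \<eta> :: "'a::euclidean_space set"
  assumes "\<eta> \<in> sets borel" "\<eta> \<subseteq> sphere 0 1"
  shows "emeasure sphere_lebesgue \<eta> =
         of_nat DIM('a) * emeasure lborel {x \<in> ball 0 1 - {0}. sgn x \<in> \<eta>}"
proof -
  let ?B = "ball 0 1 - {0} :: 'a set"
  let ?S = "restrict_space borel (sphere 0 1) :: 'a measure"
  have B: "?B \<in> sets lborel" by simp
  have eta: "\<eta> \<in> sets ?S"
    using assms by (simp add: sets_restrict_space_iff)
  have "sgn \<in> borel_measurable (restrict_space lborel ?B)"
    by (simp add: measurable_cong_sets[OF sets_restrict_space_cong[OF sets_lborel] refl]
        borel_measurable_continuous_on_restrict continuous_on_sgn)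
  then have m: "sgn \<in> measurable (restrict_space lborel ?B) ?S"
    by (intro measurable_restrict_space2) (auto simp: space_restrict_space norm_sgn)
  have "emeasure sphere_lebesgue \<eta> = emeasure (sphere_lborel :: 'a measure) \<eta>"
    using eta by (simp add: sphere_lebesgue_def sphere_lborel_def)
  also have "\<dots> = of_nat DIM('a) *
      emeasure (restrict_space lborel ?B) (sgn -` \<eta> \<inter> space (restrict_space lborel ?B))"
    using eta m by (simp add: sphere_lborel_def emeasure_distr)
  also have "sgn -` \<eta> \<inter> space (restrict_space lborel ?B) = {x \<in> ?B. sgn x \<in> \<eta>}"
    by (auto simp: space_restrict_space)
  also have "emeasure (restrict_space lborel ?B) {x \<in> ?B. sgn x \<in> \<eta>} =
      emeasure lborel {x \<in> ?B. sgn x \<in> \<eta>}"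
    using B by (intro emeasure_restrict_space) auto
  finally show ?thesis .
qed


subsection \<open>Convex bodies and star bodies\<close>

text \<open>
  The suprema below are maxima for the bodies considered, see
  \<open>radial_function_is_max\<close> and \<open>support_function_is_max\<close>.
\<close>

definition radial_function :: "'a::euclidean_space set \<Rightarrow> 'a \<Rightarrow> real" where
  "radial_function Q u = Sup {l. 0 \<le> l \<and> l *\<^sub>R u \<in> Q}"

definition support_function :: "'a::euclidean_space set \<Rightarrow> 'a \<Rightarrow> real" where
  "support_function K v = (SUP x\<in>K. v \<bullet> x)"

definition convex_body :: "'a::euclidean_space set \<Rightarrow> bool" where
  "convex_body K \<longleftrightarrow> compact K \<and> convex K \<and> interior K \<noteq> {}"

definition star_body :: "'a::euclidean_space set \<Rightarrow> bool" where
  "star_body Q \<longleftrightarrow> compact Q \<and> (\<forall>x\<in>Q. closed_segment 0 x \<subseteq> Q) \<and>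
     continuous_on (sphere 0 1) (radial_function Q)"

definition convex_bodies_o :: "'a::euclidean_space set set" where
  "convex_bodies_o = {K. convex_body K \<and> 0 \<in> interior K}"

definition star_bodies_o :: "'a::euclidean_space set set" where
  "star_bodies_o = {Q. star_body Q \<and> 0 \<in> interior Q}"

lemma radial_function_is_max:
  fixes Q :: "'a::euclidean_space set"
  assumes "compact Q" "0 \<in> Q" "norm u = 1"
  shows "0 \<le> radial_function Q u" "radial_function Q u *\<^sub>R u \<in> Q"
    and "\<And>l. 0 \<le> l \<Longrightarrow> l *\<^sub>R u \<in> Q \<Longrightarrow> l \<le> radial_function Q u"
proof -
  define A where "A = {l. 0 \<le> l \<and> l *\<^sub>R u \<in> Q}"
  have A: "A = {0..} \<inter> (\<lambda>l. l *\<^sub>R u) -` Q" by (auto simp: A_def)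
  have "closed A"
    unfolding A using assms
    by (intro closed_Int closed_atLeast closed_vimage continuous_intros compact_imp_closed)
  obtain b where "\<And>x. x \<in> Q \<Longrightarrow> norm x \<le> b"
    using compact_imp_bounded[OF assms(1)] by (auto simp: bounded_iff)
  then have bdd: "bdd_above A"
    using assms(3) by (intro bdd_aboveI[of _ b]) (force simp: A_def)
  have "0 \<in> A" using assms by (simp add: A_def)
  then have "Sup A \<in> A"
    using closed_contains_Sup[OF _ bdd \<open>closed A\<close>] by auto
  then show "0 \<le> radial_function Q u" "radial_function Q u *\<^sub>R u \<in> Q"
    by (auto simp: radial_function_def A_def)
  show "l \<le> radial_function Q u" if "0 \<le> l" "l *\<^sub>R u \<in> Q" for l
    using cSup_upper[OF _ bdd, of l] that by (auto simp: radial_function_def A_def)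
qed

lemma support_function_is_max:
  fixes K :: "'a::euclidean_space set"
  assumes "compact K" "K \<noteq> {}"
  shows "\<exists>x\<in>K. support_function K v = v \<bullet> x \<and> (\<forall>y\<in>K. v \<bullet> y \<le> v \<bullet> x)"
proof -
  obtain x where "x \<in> K" "\<And>y. y \<in> K \<Longrightarrow> v \<bullet> y \<le> v \<bullet> x"
    using continuous_attains_sup[OF assms, of "\<lambda>y. v \<bullet> y"]
    by (force intro: continuous_intros)
  then show ?thesis
    unfolding support_function_def by (intro bexI[of _ x] conjI cSup_eq_maximum) auto
qed


subsection \<open>Dual curvature measures\<close>

text \<open>The reverse radial Gauss image \<open>\<alpha>\<^sup>*\<^sub>K(\<eta>)\<close>, for \<open>\<eta> \<subseteq> sphere 0 1\<close>.\<close>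

definition reverse_radial_gauss_image :: "'a::euclidean_space set \<Rightarrow> 'a set \<Rightarrow> 'a set" where
  "reverse_radial_gauss_image K \<eta> =
     {u \<in> sphere 0 1. \<exists>v\<in>\<eta>. (radial_function K u *\<^sub>R u) \<bullet> v = support_function K v}"

definition dual_curvature ::
    "real \<Rightarrow> 'a::euclidean_space set \<Rightarrow> 'a set \<Rightarrow> 'a set \<Rightarrow> ennreal" where
  "dual_curvature q K Q \<eta> = ennreal (1 / real DIM('a)) *
     (\<integral>\<^sup>+u \<in> reverse_radial_gauss_image K \<eta>.
        ennreal (radial_function K u powr q * radial_function Q u powr (real DIM('a) - q))
      \<partial>sphere_lebesgue)"

definition dual_curvature_measure ::
    "real \<Rightarrow> 'a::euclidean_space set \<Rightarrow> 'a set \<Rightarrow> 'a measure" where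
  "dual_curvature_measure q K Q =
     measure_of (sphere 0 1) (sets (restrict_space borel (sphere 0 1))) (dual_curvature q K Q)"

definition Lp_dual_curvature_measure ::
    "real \<Rightarrow> real \<Rightarrow> 'a::euclidean_space set \<Rightarrow> 'a set \<Rightarrow> 'a measure" where
  "Lp_dual_curvature_measure p q K Q =
     density (dual_curvature_measure q K Q) (\<lambda>v. ennreal (support_function K v powr (- p)))"

end

theory Submission
  imports Defs
begin

text \<open>
  Write \<open>h\<close> for support functions, \<open>\<rho>\<close> for radial functions and \<open>\<alpha>\<^sub>K(u)\<close> for an outer unit
  normal of \<open>K\<close> at \<open>\<rho>\<^sub>K(u) u\<close>. Put \<open>f = h\<^sub>K / h\<^sub>L\<close> and \<open>g = \<rho>\<^sub>K / \<rho>\<^sub>L\<close>. Since a normal at a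
  boundary point gives \<open>h = \<rho> (u \<bullet> v)\<close>, and any other direction only \<open>h \<ge> \<rho> (u \<bullet> v)\<close>, the ratios
  are ordered: \<open>f(\<alpha>\<^sub>K(u)) \<le> g(u) \<le> f(\<alpha>\<^sub>L(u))\<close> (\<open>support_ratio_le_radial_ratio\<close>).

  Let \<open>c du\<close> be the measure on directions whose image under \<open>\<alpha>\<^sub>L\<close> is the \<open>q\<close>-th dual curvature
  measure of \<open>L\<close>; the corresponding measure for \<open>K\<close> is \<open>g^q c du\<close>. Equality of the \<open>L\<^sub>p\<close> dual
  curvature measures says that the image of \<open>g^q c du\<close> under \<open>\<alpha>\<^sub>K\<close> is \<open>f^p\<close> times the image of
  \<open>c du\<close> under \<open>\<alpha>\<^sub>L\<close>. Choose \<open>s\<close> with \<open>s \<ge> 0\<close> and \<open>s + q \<ge> 0\<close>, and integrate \<open>f^s\<close> over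
  \<open>{f > 1}\<close>. With \<open>b(u) = f(\<alpha>\<^sub>L(u))\<close> this gives

  \<open>\<integral>\<^bsub>b>1\<^esub> b^(s+p) c du = \<integral>\<^bsub>f(\<alpha>\<^sub>K)>1\<^esub> f(\<alpha>\<^sub>K)^s g^q c du \<le> \<integral>\<^bsub>b>1\<^esub> b^(s+q) c du < \<infinity>\<close>,

  where the comparison of the last two integrals uses \<open>f(\<alpha>\<^sub>K)^s g^q \<le> g^(s+q) \<le> b^(s+q)\<close>.
  As \<open>q < p\<close>, the left integrand is strictly larger on \<open>{b > 1}\<close>, so this set is null.
  Hence \<open>g \<le> b \<le> 1\<close> almost everywhere; by continuity \<open>g \<le> 1\<close> everywhere, which is \<open>K \<subseteq> L\<close>
  (\<open>radial_function_le_if_Lp_dual_curvature_measure_eq\<close>). The hypotheses are symmetric in \<open>K\<close>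
  and \<open>L\<close>.

  The remaining point is that the dual curvature measures are image measures under
  \<open>\<alpha>\<^sub>K\<close> (\<open>dual_curvature_measure_eq_distr\<close>), which holds because almost every direction has only one
  normal. Normals of \<open>K\<close> at \<open>u\<close> correspond to the points in which the polar body of \<open>K\<close> is touched by
  its supporting hyperplane in direction \<open>u\<close> (\<open>normal_iff_touching\<close>). For an arbitrary compact set,
  the directions with two touching points are covered by countably many closed cones, each of which
  meets every line parallel to some coordinate axis in at most one point, and such cones are null
  (\<open>multiple_touching_points_null\<close>).
\<close>

section \<open>Directions in which a compact set is touched\<close>

text \<open>
  The directions whose supporting hyperplane touches \<open>P\<close> at a point of \<open>C\<close>. With \<open>P\<close> the
  boundary of a polar body and \<open>C\<close> a piece of it, these sets turn into reverse radial Gauss images.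
\<close>

definition touching_directions :: "'a::euclidean_space set \<Rightarrow> 'a set \<Rightarrow> 'a set" where
  "touching_directions P C = {x. \<exists>w\<in>P \<inter> C. x \<bullet> w = support_function P x}"

lemma support_function_upper:
  fixes K :: "'a::euclidean_space set"
  assumes "compact K" "x \<in> K"
  shows "v \<bullet> x \<le> support_function K v"
  using support_function_is_max[of K v] assms by force

lemma continuous_on_support_function:
  fixes K :: "'a::euclidean_space set"
  assumes "compact K" "K \<noteq> {}"
  shows "continuous_on A (support_function K)"
proof -
  obtain B where B: "\<And>x. x \<in> K \<Longrightarrow> norm x \<le> B"
    using compact_imp_bounded[OF assms(1)] by (auto simp: bounded_iff)
  have le: "support_function K v \<le> support_function K w + B * dist v w" for v w
  proof -
    obtain x where x: "x \<in> K" "support_function K v = v \<bullet> x"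
      using support_function_is_max[OF assms] by blast
    have "v \<bullet> x = w \<bullet> x + (v - w) \<bullet> x" by (simp add: inner_diff_left)
    also have "\<dots> \<le> support_function K w + norm (v - w) * norm x"
      using support_function_upper[OF assms(1) x(1)] norm_cauchy_schwarz by (rule add_mono)
    also have "\<dots> \<le> support_function K w + norm (v - w) * B"
      using B[OF x(1)] by (simp add: mult_left_mono)
    finally show ?thesis using x by (simp add: dist_norm mult.commute)
  qed
  have "0 \<le> B" using B assms(2) norm_ge_zero order_trans by blast
  have "B-lipschitz_on A (support_function K)"
  proof (intro lipschitz_onI)
    show "0 \<le> B" by fact
    show "dist (support_function K v) (support_function K w) \<le> B * dist v w" for v w
      using le[of v w] le[of w v] by (simp add: dist_real_def dist_commute abs_le_iff)
  qed
  then show ?thesis by (rule lipschitz_on_continuous_on)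
qed

text \<open>
  The pairs of a direction and a touching point form a closed set, since the support function is
  continuous, and the projection along the compact set \<open>P\<close> is a closed map.
\<close>

lemma closed_touching_directions:
  assumes "compact P" "closed C"
  shows "closed (touching_directions P C)"
proof (cases "P = {}")
  case True
  then show ?thesis by (simp add: touching_directions_def)
next
  case False
  have "continuous_on UNIV (\<lambda>z::'a \<times> 'a. support_function P (snd z))"
    by (rule continuous_on_compose2[OF continuous_on_support_function[OF assms(1) False, of UNIV]])
      (auto intro: continuous_intros)
  then have "closed {z::'a \<times> 'a. snd z \<bullet> fst z = support_function P (snd z)}"
    by (intro closed_Collect_eq continuous_intros)
  then have "closed {x. \<exists>w. w \<in> P \<inter> C \<and> (w, x) \<in> {z. snd z \<bullet> fst z = support_function P (snd z)}}"
    using assms by (intro closed_compact_projection compact_Int_closed)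
  then show ?thesis by (simp add: touching_directions_def Bex_def)
qed

lemma touching_directions_scaleR:
  assumes "compact P" "x \<in> touching_directions P C" "0 < t"
  shows "t *\<^sub>R x \<in> touching_directions P C"
proof -
  obtain w where w: "w \<in> P" "w \<in> C" "x \<bullet> w = support_function P x"
    using assms(2) by (auto simp: touching_directions_def)
  obtain y where y: "y \<in> P" "support_function P (t *\<^sub>R x) = (t *\<^sub>R x) \<bullet> y"
    using support_function_is_max[OF assms(1)] w(1) by blast
  have "(t *\<^sub>R x) \<bullet> y \<le> (t *\<^sub>R x) \<bullet> w"
    using support_function_upper[OF assms(1) y(1), of x] w(3) assms(3) by simp
  then have "(t *\<^sub>R x) \<bullet> w = support_function P (t *\<^sub>R x)"
    using support_function_upper[OF assms(1) w(1), of "t *\<^sub>R x"] y(2) by simp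
  with w show ?thesis unfolding touching_directions_def by blast
qed

text \<open>
  Monotonicity of the subdifferential of the convex function \<open>support_function P\<close>: add the two
  maximality inequalities at \<open>x\<close> and \<open>x + t e\<close>.
\<close>

lemma touching_point_mono:
  assumes "compact P" "w \<in> P" "x \<bullet> w = support_function P x"
    and "w' \<in> P" "(x + t *\<^sub>R e) \<bullet> w' = support_function P (x + t *\<^sub>R e)" "0 < t"
  shows "e \<bullet> w \<le> e \<bullet> w'"
proof -
  have "x \<bullet> w' \<le> x \<bullet> w"
    using support_function_upper[OF assms(1,4), of x] assms(3) by simp
  moreover have "(x + t *\<^sub>R e) \<bullet> w \<le> (x + t *\<^sub>R e) \<bullet> w'"
    using support_function_upper[OF assms(1,2), of "x + t *\<^sub>R e"] assms(5) by simp
  ultimately have "t * (e \<bullet> w) \<le> t * (e \<bullet> w')"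
    by (simp add: inner_add_left)
  then show ?thesis using assms(6) by simp
qed

lemma emeasure_lborel_translate:
  fixes a :: "'a::euclidean_space"
  assumes "A \<in> sets borel"
  shows "emeasure lborel ((\<lambda>x. x + a) -` A) = emeasure lborel A"
proof -
  have "emeasure lborel A = emeasure (distr lborel borel ((+) a)) A"
    by (simp add: lborel_distr_plus)
  also have "\<dots> = emeasure lborel ((+) a -` A)"
    using assms by (simp add: emeasure_distr)
  also have "(+) a -` A = (\<lambda>x. x + a) -` A" by (auto simp: add.commute)
  finally show ?thesis by simp
qed

text \<open>
  A bounded piece of \<open>A\<close> has infinitely many pairwise disjoint translates by multiples of \<open>e\<close>
  inside one ball, all of the same measure; so this measure is zero.
\<close>

lemma null_sets_lborel_transversal:
  fixes A :: "'a::euclidean_space set"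
  assumes "closed A" and transversal: "\<And>x t. x \<in> A \<Longrightarrow> x + t *\<^sub>R e \<in> A \<Longrightarrow> 0 < t \<Longrightarrow> False"
  shows "A \<in> null_sets lborel"
proof -
  have bounded_part: "A \<inter> cball 0 (real k) \<in> null_sets lborel" for k :: nat
  proof -
    define B where "B = A \<inter> cball 0 (real k)"
    \<comment> \<open>The shifts \<open>1 / (j + 1)\<close> are distinct and bounded, so all translates stay in one ball.\<close>
    define T where "T j = (\<lambda>x. x + (1 / real (Suc j)) *\<^sub>R e) -` B" for j
    have B: "B \<in> sets borel" using assms(1) by (simp add: B_def borel_closed)
    have Tm: "T j \<in> sets lborel" for j
      using measurable_sets_borel[OF _ B, of "\<lambda>x. x + (1 / real (Suc j)) *\<^sub>R e"]
      by (simp add: T_def)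
    have disj: "T i \<inter> T j = {}" if "i < j" for i j
    proof (rule ccontr)
      assume "T i \<inter> T j \<noteq> {}"
      then obtain x where x: "x + (1 / real (Suc i)) *\<^sub>R e \<in> A" "x + (1 / real (Suc j)) *\<^sub>R e \<in> A"
        by (auto simp: T_def B_def)
      have "x + (1 / real (Suc i)) *\<^sub>R e
          = (x + (1 / real (Suc j)) *\<^sub>R e) + (1 / real (Suc i) - 1 / real (Suc j)) *\<^sub>R e"
        by (simp add: algebra_simps)
      moreover have "0 < 1 / real (Suc i) - 1 / real (Suc j)"
        using that by (simp add: frac_less2)
      ultimately show False using transversal x by metis
    qed
    have "disjoint_family T"
      unfolding disjoint_family_on_def using disj by (metis Int_commute linorder_neqE_nat)
    then have "(\<Sum>j. emeasure lborel (T j)) = emeasure lborel (\<Union>j. T j)"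
      using Tm by (intro suminf_emeasure) auto
    also have "\<dots> \<le> emeasure lborel (cball 0 (real k + norm e) :: 'a set)"
    proof (rule emeasure_mono)
      show "(\<Union>j. T j) \<subseteq> cball 0 (real k + norm e)"
      proof
        fix x assume "x \<in> (\<Union>j. T j)"
        then obtain j where j: "norm (x + (1 / real (Suc j)) *\<^sub>R e) \<le> real k"
          by (auto simp: T_def B_def)
        have "norm x \<le> norm (x + (1 / real (Suc j)) *\<^sub>R e) + norm ((1 / real (Suc j)) *\<^sub>R e)"
          by (metis add_diff_cancel norm_triangle_ineq4)
        also have "norm ((1 / real (Suc j)) *\<^sub>R e) \<le> norm e"
          by (simp add: divide_le_eq mult_left_le algebra_simps)
        finally show "x \<in> cball 0 (real k + norm e)" using j by simp
      qed
    qed simp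
    also have "\<dots> < \<infinity>" using emeasure_bounded_finite[OF bounded_cball, of "0::'a" "real k + norm e"] by (simp add: less_top)
    finally have "(\<Sum>j::nat. emeasure lborel B) < \<infinity>"
      by (simp add: T_def emeasure_lborel_translate[OF B])
    then have "emeasure lborel B = 0"
      by (simp add: nn_integral_count_space_nat[symmetric] ennreal_mult_eq_top_iff less_top[symmetric])
    then show ?thesis using B by (auto simp: B_def null_sets_def)
  qed
  have "A = (\<Union>k. A \<inter> cball 0 (real k))"
    using real_arch_simple by (auto simp: set_eq_iff)
  also have "\<dots> \<in> null_sets lborel" using bounded_part by blast
  finally show ?thesis .
qed

text \<open>
  By monotonicity, moving from a direction in \<open>N\<close> forward along \<open>e\<close> forces every touching point
  to satisfy \<open>e \<bullet> w \<ge> d\<close>, so \<open>N\<close> is never met again on that line.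
\<close>

lemma separated_touching_directions_null:
  fixes P :: "'a::euclidean_space set" and e :: 'a
  assumes "compact P" "c < d"
  defines "N \<equiv> touching_directions P {w. e \<bullet> w \<le> c} \<inter> touching_directions P {w. d \<le> e \<bullet> w}"
  shows "closed N" "N \<in> null_sets lborel"
proof -
  show "closed N"
    unfolding N_def using assms(1)
    by (intro closed_Int closed_touching_directions closed_halfspace_le closed_halfspace_ge[of _ e, simplified])
  then show "N \<in> null_sets lborel"
  proof (rule null_sets_lborel_transversal)
    fix x t assume "x \<in> N" "x + t *\<^sub>R e \<in> N" and t: "0 < t"
    then obtain w w' where w: "w \<in> P" "d \<le> e \<bullet> w" "x \<bullet> w = support_function P x"
      and w': "w' \<in> P" "e \<bullet> w' \<le> c" "(x + t *\<^sub>R e) \<bullet> w' = support_function P (x + t *\<^sub>R e)"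
      unfolding N_def touching_directions_def by blast
    have "e \<bullet> w \<le> e \<bullet> w'"
      by (rule touching_point_mono[OF assms(1) w(1,3) w'(1,3) t])
    then show False using w w' \<open>c < d\<close> by simp
  qed
qed

text \<open>
  Spherical measure is volume of the cone over a set, so a cone that is Lebesgue null cuts the sphere
  in a null set.
\<close>

lemma null_sets_sphere_lebesgue_cone:
  fixes A :: "'a::euclidean_space set"
  assumes "A \<in> null_sets lborel" and cone: "\<And>x t. x \<in> A \<Longrightarrow> 0 < t \<Longrightarrow> t *\<^sub>R x \<in> A"
  shows "A \<inter> sphere 0 1 \<in> null_sets sphere_lebesgue"
proof -
  have A: "A \<in> sets borel" using assms(1) by auto
  have "{x \<in> ball 0 1 - {0}. sgn x \<in> A \<inter> sphere 0 1} \<subseteq> A"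
  proof
    fix x assume "x \<in> {x \<in> ball 0 1 - {0}. sgn x \<in> A \<inter> sphere 0 1}"
    then have x: "x \<noteq> 0" "sgn x \<in> A" by auto
    then have "norm x *\<^sub>R sgn x \<in> A" by (intro cone) auto
    then show "x \<in> A" using x by (simp add: sgn_div_norm)
  qed
  then have "emeasure lborel {x \<in> ball 0 1 - {0}. sgn x \<in> A \<inter> sphere 0 1} = 0"
    using assms(1) by (meson emeasure_eq_0 null_setsD1 null_setsD2)
  then have "emeasure sphere_lebesgue (A \<inter> sphere 0 1) = 0"
    using A by (subst emeasure_sphere_lebesgue) auto
  moreover have "A \<inter> sphere 0 1 \<in> sets (sphere_lborel :: 'a measure)"
    using A by (simp add: sphere_lborel_def sets_restrict_space_iff)
  ultimately show ?thesis by (auto simp: sphere_lebesgue_def null_sets_def)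
qed

text \<open>
  This is almost everywhere differentiability of the support function of \<open>P\<close>, in the form needed
  for normals. Two distinct touching points differ in some coordinate, and two rational numbers
  fit between the values of that coordinate; hence countably many of the null sets above suffice.
\<close>

lemma multiple_touching_points_null:
  fixes P :: "'a::euclidean_space set"
  assumes "compact P"
  shows "{u \<in> sphere 0 1. \<exists>w\<in>P. \<exists>w'\<in>P. w \<noteq> w' \<and>
      u \<bullet> w = support_function P u \<and> u \<bullet> w' = support_function P u} \<in> null_sets sphere_lebesgue"
    (is "?M \<in> _")
proof -
  define N where "N = (\<lambda>(e, c, d). touching_directions P {w. e \<bullet> w \<le> c} \<inter>
     touching_directions P {w. d \<le> e \<bullet> w})"
  define I where "I = (Basis :: 'a set) \<times> {(c, d). c \<in> \<rat> \<and> d \<in> \<rat> \<and> c < (d::real)}"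
  have "countable ({(c, d). c \<in> \<rat> \<and> d \<in> \<rat> \<and> c < (d::real)})"
    by (rule countable_subset[of _ "\<rat> \<times> \<rat>"]) (auto intro: countable_rat)
  then have "countable I"
    unfolding I_def by (intro countable_SIGMA countable_finite[OF finite_Basis])
  moreover have "N i \<inter> sphere 0 1 \<in> null_sets sphere_lebesgue" if iI: "i \<in> I" for i
  proof -
    obtain e c d where i: "i = (e, c, d)" "c < d" using iI by (auto simp: I_def)
    have "N i \<in> null_sets lborel"
      using separated_touching_directions_null(2)[OF assms i(2)] by (simp add: N_def i)
    then show ?thesis
      by (rule null_sets_sphere_lebesgue_cone)
        (auto simp: N_def i intro: touching_directions_scaleR[OF assms])
  qed
  ultimately have "(\<Union>i\<in>I. N i \<inter> sphere 0 1) \<in> null_sets sphere_lebesgue"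
    by (intro null_sets_UN') auto
  moreover have "?M \<subseteq> (\<Union>i\<in>I. N i \<inter> sphere 0 1)"
  proof clarify
    fix u w w' assume u: "u \<in> sphere 0 1" and w: "w \<in> P" "u \<bullet> w = support_function P u"
      and w': "w' \<in> P" "u \<bullet> w' = support_function P u" and "w \<noteq> w'"
    from \<open>w \<noteq> w'\<close> obtain e where e: "e \<in> Basis" "e \<bullet> w \<noteq> e \<bullet> w'"
      by (metis euclidean_eqI inner_commute)
    have ordered: "u \<in> (\<Union>i\<in>I. N i \<inter> sphere 0 1)"
      if lt: "e \<bullet> v < e \<bullet> v'" and v: "v \<in> P" "u \<bullet> v = support_function P u"
        and v': "v' \<in> P" "u \<bullet> v' = support_function P u" for v v'
    proof -
      obtain c where c: "c \<in> \<rat>" "e \<bullet> v < c" "c < e \<bullet> v'" using Rats_dense_in_real[OF lt] by blast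
      obtain d where d: "d \<in> \<rat>" "c < d" "d < e \<bullet> v'" using Rats_dense_in_real[OF c(3)] by blast
      have "(e, c, d) \<in> I" using e c d by (simp add: I_def)
      moreover have "u \<in> N (e, c, d)"
        unfolding N_def touching_directions_def using v v' c d by auto
      ultimately show ?thesis using u by blast
    qed
    show "u \<in> (\<Union>i\<in>I. N i \<inter> sphere 0 1)"
      using e(2) ordered[OF _ w w'] ordered[OF _ w' w] by (meson linorder_neqE_linordered_idom)
  qed
  ultimately show ?thesis
    unfolding sphere_lebesgue_def using null_sets_completion_subset by blast
qed

section \<open>Outer normals and the polar body\<close>

lemma radial_function_pos:
  fixes Q :: "'a::euclidean_space set"
  assumes "compact Q" "0 \<in> interior Q" "u \<in> sphere 0 1"
  shows "0 < radial_function Q u"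
proof -
  obtain r where r: "0 < r" "cball 0 r \<subseteq> Q"
    using assms(2) by (auto simp: mem_interior_cball)
  have "r *\<^sub>R u \<in> Q" using r assms(3) by (intro subsetD[OF r(2)]) simp
  moreover have "0 \<in> Q" using assms(2) interior_subset by blast
  ultimately have "r \<le> radial_function Q u"
    using radial_function_is_max(3)[OF assms(1), of u r] assms(3) r by simp
  with r show ?thesis by simp
qed

lemma support_function_pos:
  fixes K :: "'a::euclidean_space set"
  assumes "compact K" "0 \<in> interior K" "v \<in> sphere 0 1"
  shows "0 < support_function K v"
proof -
  have "0 \<in> K" using assms(2) interior_subset by blast
  then have "radial_function K v *\<^sub>R v \<in> K"
    using radial_function_is_max(2)[OF assms(1), of v] assms(3) by simp
  then have "v \<bullet> (radial_function K v *\<^sub>R v) \<le> support_function K v"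
    by (rule support_function_upper[OF assms(1)])
  then show ?thesis
    using radial_function_pos[OF assms] assms(3) by (simp add: dot_square_norm)
qed

lemma radial_inner_le_support:
  fixes K :: "'a::euclidean_space set"
  assumes "compact K" "0 \<in> K" "u \<in> sphere 0 1"
  shows "radial_function K u * (u \<bullet> v) \<le> support_function K v"
  using support_function_upper[OF assms(1), of "radial_function K u *\<^sub>R u" v]
    radial_function_is_max(2)[OF assms(1,2), of u] assms(3) by (simp add: inner_commute)

text \<open>
  The point \<open>radial_function K u *\<^sub>R u\<close> is not interior, because \<open>K\<close> contains nothing further out
  on its ray; a supporting hyperplane there gives the normal.
\<close>

lemma outer_normal_exists:
  fixes K :: "'a::euclidean_space set"
  assumes "compact K" "convex K" "0 \<in> interior K" "u \<in> sphere 0 1"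
  obtains v where "v \<in> sphere 0 1" "radial_function K u * (u \<bullet> v) = support_function K v"
proof -
  let ?x = "radial_function K u *\<^sub>R u"
  have K0: "0 \<in> K" using assms(3) interior_subset by blast
  have x: "?x \<in> K" using radial_function_is_max(2)[OF assms(1) K0] assms(4) by simp
  have "?x \<notin> interior K"
  proof
    assume "?x \<in> interior K"
    then obtain r where r: "0 < r" "cball ?x r \<subseteq> K"
      by (auto simp: mem_interior_cball)
    have "(radial_function K u + r) *\<^sub>R u \<in> K"
      using r assms(4) by (intro subsetD[OF r(2)]) (simp add: dist_norm algebra_simps)
    then show False
      using radial_function_is_max(3)[OF assms(1) K0, of u "radial_function K u + r"]
        radial_function_pos[OF assms(1,3,4)] r(1) assms(4) by simp
  qed
  then have "?x \<notin> rel_interior K"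
    using assms(3) by (subst rel_interior_nonempty_interior) auto
  then obtain a where a: "a \<noteq> 0" "\<And>y. y \<in> K \<Longrightarrow> a \<bullet> ?x \<le> a \<bullet> y"
    using supporting_hyperplane_rel_boundary[OF assms(2) x] by metis
  \<comment> \<open>The functional \<open>a\<close> is minimal over \<open>K\<close> at the boundary point, so the outer normal is \<open>- a\<close>.\<close>
  define v where "v = - sgn a"
  have v: "v \<in> sphere 0 1" using a by (simp add: v_def norm_sgn)
  have max: "v \<bullet> y \<le> v \<bullet> ?x" if "y \<in> K" for y
    using a(2)[OF that] by (simp add: v_def sgn_div_norm divide_simps)
  obtain y where y: "y \<in> K" "support_function K v = v \<bullet> y"
    using support_function_is_max[OF assms(1)] K0 by blast
  have "v \<bullet> ?x = support_function K v"
    using max[OF y(1)] support_function_upper[OF assms(1) x, of v] y(2) by simp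
  then show thesis using that v by (simp add: inner_commute)
qed

text \<open>
  For a convex body with the origin in its interior, \<open>polar_point K v\<close> is the boundary point of the
  polar body in direction \<open>v\<close>: its norm is \<open>1 / support_function K v\<close>.
\<close>

definition polar_point :: "'a::euclidean_space set \<Rightarrow> 'a \<Rightarrow> 'a" where
  "polar_point K v = v /\<^sub>R support_function K v"

lemma continuous_on_polar_point:
  fixes K :: "'a::euclidean_space set"
  assumes "compact K" "0 \<in> interior K"
  shows "continuous_on (sphere 0 1) (polar_point K)"
proof -
  have "K \<noteq> {}" using assms(2) interior_subset by blast
  then show ?thesis
    unfolding polar_point_def
    using support_function_pos[OF assms] continuous_on_support_function[OF assms(1)]
    by (intro continuous_intros) force+
qed

lemma inj_on_polar_point:
  fixes K :: "'a::euclidean_space set"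
  assumes "compact K" "0 \<in> interior K"
  shows "inj_on (polar_point K) (sphere 0 1)"
proof (rule inj_onI)
  fix v w :: 'a assume v: "v \<in> sphere 0 1" and w: "w \<in> sphere 0 1" and eq: "polar_point K v = polar_point K w"
  have "norm (polar_point K v) = norm (polar_point K w)" using eq by simp
  then have "support_function K v = support_function K w"
    using v w support_function_pos[OF assms v] support_function_pos[OF assms w]
    by (simp add: polar_point_def)
  then have "v /\<^sub>R support_function K v = w /\<^sub>R support_function K v"
    using eq by (simp add: polar_point_def)
  then show "v = w"
    using support_function_pos[OF assms v] by simp
qed

text \<open>
  The polarity relation between radial and support functions. All points \<open>polar_point K v\<close> satisfy
  \<open>u \<bullet> polar_point K v \<le> 1 / radial_function K u\<close>, with equality exactly for the normals \<open>v\<close>.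
\<close>

lemma support_function_polar_boundary:
  fixes K :: "'a::euclidean_space set"
  assumes "compact K" "convex K" "0 \<in> interior K" "u \<in> sphere 0 1"
  shows "support_function (polar_point K ` sphere 0 1) u = 1 / radial_function K u"
proof -
  have r: "0 < radial_function K u" by (rule radial_function_pos[OF assms(1,3,4)])
  obtain v where v: "v \<in> sphere 0 1" "radial_function K u * (u \<bullet> v) = support_function K v"
    using outer_normal_exists[OF assms] .
  have K0: "0 \<in> K" using assms(3) interior_subset by blast
  show ?thesis
    unfolding support_function_def[of "polar_point K ` _"]
  proof (rule cSup_eq_maximum)
    have "u \<bullet> polar_point K v = 1 / radial_function K u"
      using r support_function_pos[OF assms(1,3) v(1)] v(2)
      by (simp add: polar_point_def field_simps)
    then show "1 / radial_function K u \<in> (\<bullet>) u ` polar_point K ` sphere 0 1"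
      using v(1) by (metis imageI)
  next
    fix y assume "y \<in> (\<bullet>) u ` polar_point K ` sphere 0 1"
    then obtain w where w: "w \<in> sphere 0 1" "y = u \<bullet> polar_point K w" by blast
    have "u \<bullet> w / support_function K w \<le> 1 / radial_function K u"
      using r support_function_pos[OF assms(1,3) w(1)] radial_inner_le_support[OF assms(1) K0 assms(4), of w]
      by (simp add: frac_le_eq divide_simps mult.commute)
    then show "y \<le> 1 / radial_function K u"
      using w(2) by (simp add: polar_point_def divide_inverse_commute)
  qed
qed

lemma continuous_on_radial_function:
  fixes K :: "'a::euclidean_space set"
  assumes "compact K" "convex K" "0 \<in> interior K"
  shows "continuous_on (sphere 0 1) (radial_function K)"
proof (cases "sphere 0 1 = ({} :: 'a set)")
  case True
  then show ?thesis by (metis continuous_on_empty)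
next
  case False
  let ?P = "polar_point K ` sphere 0 1"
  have "compact ?P"
    using assms by (intro compact_continuous_image continuous_on_polar_point) auto
  then have "continuous_on (sphere 0 1) (support_function ?P)"
    using False by (intro continuous_on_support_function) auto
  then have "continuous_on (sphere 0 1) (\<lambda>u. 1 / support_function ?P u)"
    using support_function_polar_boundary[OF assms] radial_function_pos[OF assms(1,3)]
    by (intro continuous_intros) force+
  then show ?thesis
    by (rule continuous_on_eq) (simp add: support_function_polar_boundary[OF assms])
qed

text \<open>
  Normals of \<open>K\<close> are touching points of the polar body. This transfers closedness and almost
  everywhere uniqueness from touching points to normals.
\<close>

lemma normal_iff_touching:
  fixes K :: "'a::euclidean_space set"
  assumes "compact K" "convex K" "0 \<in> interior K" "u \<in> sphere 0 1" "v \<in> sphere 0 1"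
  shows "radial_function K u * (u \<bullet> v) = support_function K v \<longleftrightarrow>
    u \<bullet> polar_point K v = support_function (polar_point K ` sphere 0 1) u"
  using radial_function_pos[OF assms(1,3,4)] support_function_pos[OF assms(1,3,5)]
  unfolding support_function_polar_boundary[OF assms(1-4)] polar_point_def inner_scaleR_right
  by (auto simp: field_simps)

lemma closed_reverse_radial_gauss_image:
  fixes K :: "'a::euclidean_space set"
  assumes "compact K" "convex K" "0 \<in> interior K" "closed \<eta>" "\<eta> \<subseteq> sphere 0 1"
  shows "closed (reverse_radial_gauss_image K \<eta>)"
proof -
  let ?P = "polar_point K ` sphere 0 1"
  have cont: "continuous_on (sphere 0 1) (polar_point K)"
    by (rule continuous_on_polar_point[OF assms(1,3)])
  have "compact \<eta>" using compact_Int_closed[OF compact_sphere[of 0 1] assms(4)] assms(5) by (simp add: inf.absorb2)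
  then have "closed (polar_point K ` \<eta>)"
    by (intro compact_imp_closed compact_continuous_image continuous_on_subset[OF cont assms(5)])
  then have "closed (sphere 0 1 \<inter> touching_directions ?P (polar_point K ` \<eta>))"
    using cont by (intro closed_Int closed_sphere closed_touching_directions compact_continuous_image compact_sphere)
  also have "sphere 0 1 \<inter> touching_directions ?P (polar_point K ` \<eta>) = reverse_radial_gauss_image K \<eta>"
  proof -
    have "(\<exists>w\<in>?P \<inter> polar_point K ` \<eta>. u \<bullet> w = support_function ?P u) \<longleftrightarrow>
        (\<exists>v\<in>\<eta>. (radial_function K u *\<^sub>R u) \<bullet> v = support_function K v)" if u: "u \<in> sphere 0 1" for u
    proof -
      have "?P \<inter> polar_point K ` \<eta> = polar_point K ` \<eta>" using assms(5) by blast
      then show ?thesis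
        using normal_iff_touching[OF assms(1-3) u] assms(5) by (simp add: subset_iff)
    qed
    then show ?thesis
      unfolding reverse_radial_gauss_image_def touching_directions_def by blast
  qed
  finally show ?thesis .
qed

lemma multiple_normals_null:
  fixes K :: "'a::euclidean_space set"
  assumes "compact K" "convex K" "0 \<in> interior K"
  shows "{u \<in> sphere 0 1. \<exists>v\<in>sphere 0 1. \<exists>w\<in>sphere 0 1. v \<noteq> w \<and>
     radial_function K u * (u \<bullet> v) = support_function K v \<and>
     radial_function K u * (u \<bullet> w) = support_function K w} \<in> null_sets sphere_lebesgue"
    (is "?N \<in> _")
proof -
  let ?P = "polar_point K ` sphere 0 1"
  let ?M = "{u \<in> sphere 0 1. \<exists>w\<in>?P. \<exists>w'\<in>?P. w \<noteq> w' \<and>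
      u \<bullet> w = support_function ?P u \<and> u \<bullet> w' = support_function ?P u}"
  have "compact ?P"
    using assms by (intro compact_continuous_image continuous_on_polar_point) auto
  then have "?M \<in> null_sets sphere_lebesgue" by (rule multiple_touching_points_null)
  moreover have "?N \<subseteq> ?M"
  proof clarify
    fix u v w :: 'a assume u: "u \<in> sphere 0 1"
      and v: "v \<in> sphere 0 1" "radial_function K u * (u \<bullet> v) = support_function K v"
      and w: "w \<in> sphere 0 1" "radial_function K u * (u \<bullet> w) = support_function K w"
      and "v \<noteq> w"
    have "polar_point K v \<noteq> polar_point K w"
      using \<open>v \<noteq> w\<close> inj_onD[OF inj_on_polar_point[OF assms(1,3)]] v(1) w(1) by blast
    moreover have "u \<bullet> polar_point K v = support_function ?P u"
      using normal_iff_touching[OF assms u v(1)] v(2) by blast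
    moreover have "u \<bullet> polar_point K w = support_function ?P u"
      using normal_iff_touching[OF assms u w(1)] w(2) by blast
    ultimately show "\<exists>w\<in>?P. \<exists>w'\<in>?P. w \<noteq> w' \<and>
        u \<bullet> w = support_function ?P u \<and> u \<bullet> w' = support_function ?P u"
      using v(1) w(1) by (intro bexI[OF _ imageI[OF v(1)]] bexI[OF _ imageI[OF w(1)]]) blast
  qed
  ultimately show ?thesis
    unfolding sphere_lebesgue_def using null_sets_completion_subset by blast
qed

section \<open>Dual curvature measures as image measures\<close>

text \<open>
  An arbitrary choice of an outer normal at \<open>radial_function K u *\<^sub>R u\<close>. The choice matters only on
  a null set, and its measurability for the completed spherical measure is proved below.
\<close>

definition radial_gauss_map :: "'a::euclidean_space set \<Rightarrow> 'a \<Rightarrow> 'a" where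
  "radial_gauss_map K u =
     (SOME v. v \<in> sphere 0 1 \<and> radial_function K u * (u \<bullet> v) = support_function K v)"

lemma convex_bodies_oD:
  assumes "K \<in> convex_bodies_o"
  shows "compact K" "convex K" "0 \<in> interior K" "0 \<in> K"
  using assms interior_subset by (auto simp: convex_bodies_o_def convex_body_def)

lemma radial_gauss_map:
  assumes "K \<in> convex_bodies_o" "u \<in> sphere 0 1"
  shows "radial_gauss_map K u \<in> sphere 0 1"
    and "radial_function K u * (u \<bullet> radial_gauss_map K u) = support_function K (radial_gauss_map K u)"
proof -
  obtain v where "v \<in> sphere 0 1 \<and> radial_function K u * (u \<bullet> v) = support_function K v"
    using outer_normal_exists[OF convex_bodies_oD(1-3)[OF assms(1)] assms(2)] by blast
  from someI[where P = "\<lambda>v. v \<in> sphere 0 1 \<and> radial_function K u * (u \<bullet> v) = support_function K v", OF this]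
  show "radial_gauss_map K u \<in> sphere 0 1"
    "radial_function K u * (u \<bullet> radial_gauss_map K u) = support_function K (radial_gauss_map K u)"
    unfolding radial_gauss_map_def by blast+
qed

lemma space_sphere_lebesgue [simp]: "space sphere_lebesgue = sphere 0 1"
  by (simp add: sphere_lebesgue_def sphere_lborel_def space_restrict_space space_scale_measure)

lemma sets_sphere_lebesgueI:
  fixes A :: "'a::euclidean_space set"
  assumes "A \<in> sets borel" "A \<subseteq> sphere 0 1"
  shows "A \<in> sets sphere_lebesgue"
proof -
  have "A \<in> sets (sphere_lborel :: 'a measure)"
    using assms by (simp add: sphere_lborel_def sets_restrict_space_iff)
  then show ?thesis by (simp add: sphere_lebesgue_def)
qed

lemma borel_measurable_sphere_lebesgue:
  fixes f :: "'a::euclidean_space \<Rightarrow> real"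
  assumes "continuous_on (sphere 0 1) f"
  shows "f \<in> borel_measurable sphere_lebesgue"
proof -
  have "f \<in> borel_measurable (restrict_space borel (sphere 0 1))"
    by (rule borel_measurable_continuous_on_restrict[OF assms])
  then have "f \<in> borel_measurable sphere_lborel"
    by (simp add: sphere_lborel_def cong: measurable_cong_sets)
  then show ?thesis unfolding sphere_lebesgue_def by (rule measurable_completion)
qed

lemma emeasure_sphere_lebesgue_finite:
  "emeasure sphere_lebesgue (sphere 0 1 :: 'a::euclidean_space set) < \<infinity>"
proof -
  have "emeasure lborel {x \<in> ball 0 1 - {0 :: 'a}. sgn x \<in> sphere 0 1} \<le> emeasure lborel (ball 0 1 :: 'a set)"
    by (intro emeasure_mono) auto
  also have "\<dots> < \<infinity>"
    using emeasure_bounded_finite[OF bounded_ball, of "0::'a" 1] by (simp add: less_top)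
  finally show ?thesis
    by (subst emeasure_sphere_lebesgue) (auto simp: ennreal_mult_less_top of_nat_less_top)
qed

text \<open>
  The cone over a nonempty relatively open subset of the sphere contains a nonempty open set, so it
  has positive volume. Hence an inequality between continuous functions that holds almost everywhere
  holds everywhere.
\<close>

lemma AE_sphere_lebesgue_le_0_imp_le_0:
  fixes f :: "'a::euclidean_space \<Rightarrow> real"
  assumes cont: "continuous_on (sphere 0 1) f" and null: "AE u in sphere_lebesgue. f u \<le> 0"
    and u: "u \<in> sphere 0 1"
  shows "f u \<le> 0"
proof (rule ccontr)
  assume "\<not> f u \<le> 0"
  let ?B = "ball 0 1 - {0 :: 'a}"
  let ?A = "{v \<in> sphere 0 1. 0 < f v}"
  let ?C = "{x \<in> ?B. 0 < f (sgn x)}"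
  have "continuous_on ?B (\<lambda>x. f (sgn x))"
    by (rule continuous_on_compose2[OF cont]) (auto intro!: continuous_on_sgn continuous_intros simp: norm_sgn split: if_splits)
  then have "open (?B \<inter> (\<lambda>x. f (sgn x)) -` {0<..})"
    by (intro continuous_open_preimage) auto
  also have "?B \<inter> (\<lambda>x. f (sgn x)) -` {0<..} = ?C" by auto
  finally have "open ?C" .
  moreover have "(1/2) *\<^sub>R u \<in> ?C"
    using u \<open>\<not> f u \<le> 0\<close> by (auto simp: sgn_div_norm)
  ultimately have "?C \<notin> null_sets lborel"
    using open_not_negligible[of ?C] null_sets_completionI[of ?C lborel] unfolding negligible_iff_null_sets
    by blast
  then have "0 < emeasure lborel ?C"
    using \<open>open ?C\<close> by (auto simp: null_sets_def zero_less_iff_neq_zero)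
  also have "?C = {x \<in> ?B. sgn x \<in> ?A}" by (auto simp: norm_sgn)
  finally have pos: "0 < emeasure lborel {x \<in> ?B. sgn x \<in> ?A}" .
  have A: "?A \<in> sets borel"
  proof -
    have "openin (top_of_set (sphere 0 1)) ?A"
      using continuous_openin_preimage_gen[OF cont open_greaterThan[of 0]] by (simp add: vimage_def Int_def)
    then show ?thesis by (auto simp: openin_open)
  qed
  have "0 < emeasure sphere_lebesgue ?A"
    unfolding emeasure_sphere_lebesgue[OF A Collect_subset]
    using pos by (simp add: ennreal_zero_less_mult_iff del: mem_sphere)
  moreover have "emeasure sphere_lebesgue ?A = 0"
    using null AE_iff_measurable[OF sets_sphere_lebesgueI[OF A Collect_subset], of "\<lambda>u. f u \<le> 0"]
    by (auto simp: not_le)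
  ultimately show False by simp
qed

text \<open>Both sides can differ only at directions with at least two normals.\<close>

lemma AE_reverse_radial_gauss_image:
  fixes K :: "'a::euclidean_space set"
  assumes "K \<in> convex_bodies_o" "\<eta> \<subseteq> sphere 0 1"
  shows "AE u in sphere_lebesgue. u \<in> reverse_radial_gauss_image K \<eta> \<longleftrightarrow> radial_gauss_map K u \<in> \<eta>"
proof (rule AE_I'[OF multiple_normals_null[OF convex_bodies_oD(1-3)[OF assms(1)]]], clarify)
  fix u :: 'a assume "u \<in> space sphere_lebesgue"
    and neq: "\<not> (u \<in> reverse_radial_gauss_image K \<eta> \<longleftrightarrow> radial_gauss_map K u \<in> \<eta>)"
  then have u: "u \<in> sphere 0 1" by simp
  note G = radial_gauss_map[OF assms(1) u]
  from neq obtain v where v: "v \<in> \<eta>" "v \<noteq> radial_gauss_map K u"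
    "radial_function K u * (u \<bullet> v) = support_function K v"
    using u G(2) by (auto simp: reverse_radial_gauss_image_def)
  show "u \<in> sphere 0 1 \<and> (\<exists>v\<in>sphere 0 1. \<exists>w\<in>sphere 0 1. v \<noteq> w \<and>
     radial_function K u * (u \<bullet> v) = support_function K v \<and>
     radial_function K u * (u \<bullet> w) = support_function K w)"
    using u v G assms(2) by blast
qed

text \<open>
  The preimage of a closed set differs by a null set from a reverse radial Gauss image, which is
  closed. Completeness of the spherical measure absorbs the difference.
\<close>

lemma measurable_radial_gauss_map:
  fixes K :: "'a::euclidean_space set"
  assumes "K \<in> convex_bodies_o"
  shows "radial_gauss_map K \<in> measurable sphere_lebesgue (restrict_space borel (sphere 0 1))"
proof (rule measurable_restrict_space2)
  show "radial_gauss_map K \<in> space sphere_lebesgue \<rightarrow> sphere 0 1"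
    using radial_gauss_map(1)[OF assms] by simp
  show "radial_gauss_map K \<in> borel_measurable sphere_lebesgue"
  proof (rule borel_measurableI)
    fix U :: "'a set" assume "open U"
    let ?\<eta> = "sphere 0 1 - U"
    have "closed (reverse_radial_gauss_image K ?\<eta>)"
      using \<open>open U\<close> by (intro closed_reverse_radial_gauss_image convex_bodies_oD[OF assms]) auto
    then have "reverse_radial_gauss_image K ?\<eta> \<in> sets sphere_lebesgue"
      by (intro sets_sphere_lebesgueI borel_closed) (auto simp: reverse_radial_gauss_image_def)
    then have compl: "sphere 0 1 - reverse_radial_gauss_image K ?\<eta> \<in> sets sphere_lebesgue"
      by (metis sets.compl_sets space_sphere_lebesgue)
    have ae: "AE u in sphere_lebesgue.
        u \<in> sphere 0 1 - reverse_radial_gauss_image K ?\<eta> \<longleftrightarrow>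
        u \<in> radial_gauss_map K -` U \<inter> space sphere_lebesgue"
      using AE_reverse_radial_gauss_image[OF assms Diff_subset, of U] AE_space
      by eventually_elim (use radial_gauss_map(1)[OF assms] in auto)
    show "radial_gauss_map K -` U \<inter> space sphere_lebesgue \<in> sets sphere_lebesgue"
      using ae compl unfolding sphere_lebesgue_def
      by (rule completion.in_sets_AE) (rule Int_lower2)
  qed
qed

text \<open>The density, with respect to spherical measure, of the measure whose image is the dual curvature measure.\<close>

definition dual_curvature_density :: "real \<Rightarrow> 'a::euclidean_space set \<Rightarrow> 'a set \<Rightarrow> 'a \<Rightarrow> real" where
  "dual_curvature_density q K Q u =
     1 / real DIM('a) * (radial_function K u powr q * radial_function Q u powr (real DIM('a) - q))"

lemma continuous_on_radial_function_bodies: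
  "K \<in> convex_bodies_o \<Longrightarrow> continuous_on (sphere 0 1) (radial_function K)"
  "Q \<in> star_bodies_o \<Longrightarrow> continuous_on (sphere 0 1) (radial_function Q)"
  using continuous_on_radial_function convex_bodies_oD
  by (auto simp: star_bodies_o_def star_body_def)

lemma radial_function_pos_bodies:
  "K \<in> convex_bodies_o \<Longrightarrow> u \<in> sphere 0 1 \<Longrightarrow> 0 < radial_function K u"
  "Q \<in> star_bodies_o \<Longrightarrow> u \<in> sphere 0 1 \<Longrightarrow> 0 < radial_function Q u"
  by (rule radial_function_pos[OF convex_bodies_oD(1,3)]) (auto intro!: radial_function_pos simp: star_bodies_o_def star_body_def)

lemma continuous_on_dual_curvature_density:
  assumes "K \<in> convex_bodies_o" "Q \<in> star_bodies_o"
  shows "continuous_on (sphere 0 1) (dual_curvature_density q K Q)"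
  unfolding dual_curvature_density_def
  using radial_function_pos_bodies(1)[OF assms(1)] radial_function_pos_bodies(2)[OF assms(2)]
  by (intro continuous_intros continuous_on_radial_function_bodies assms) force+

lemma dual_curvature_density_pos:
  fixes K :: "'a::euclidean_space set"
  assumes "K \<in> convex_bodies_o" "Q \<in> star_bodies_o" "u \<in> sphere 0 1"
  shows "0 < dual_curvature_density q K Q u"
  unfolding dual_curvature_density_def
  using radial_function_pos_bodies(1)[OF assms(1,3)] radial_function_pos_bodies(2)[OF assms(2,3)]
  by simp

text \<open>
  In particular the set function \<open>dual_curvature\<close> is countably additive on Borel sets, so
  \<open>measure_of\<close> returns a measure with these values and not the zero measure it falls back to
  otherwise.
\<close>

lemma dual_curvature_measure_eq_distr:
  fixes K Q :: "'a::euclidean_space set"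
  assumes "K \<in> convex_bodies_o" "Q \<in> star_bodies_o"
  shows "dual_curvature_measure q K Q =
    distr (density sphere_lebesgue (\<lambda>u. ennreal (dual_curvature_density q K Q u)))
      (restrict_space borel (sphere 0 1)) (radial_gauss_map K)"
    (is "_ = ?M")
proof -
  let ?S = "restrict_space borel (sphere 0 1) :: 'a measure"
  let ?g = "\<lambda>u. radial_function K u powr q * radial_function Q u powr (real DIM('a) - q)"
  note meas [measurable] = measurable_radial_gauss_map[OF assms(1)]
    borel_measurable_sphere_lebesgue[OF continuous_on_dual_curvature_density[OF assms, of q]]
    borel_measurable_sphere_lebesgue[OF continuous_on_radial_function_bodies(1)[OF assms(1)]]
    borel_measurable_sphere_lebesgue[OF continuous_on_radial_function_bodies(2)[OF assms(2)]]
  have dual: "dual_curvature q K Q \<eta> = emeasure ?M \<eta>" if eta: "\<eta> \<in> sets ?S" for \<eta>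
  proof -
    have sub: "\<eta> \<subseteq> sphere 0 1" using eta by (auto simp: sets_restrict_space)
    let ?V = "radial_gauss_map K -` \<eta> \<inter> sphere 0 1"
    have V [measurable]: "?V \<in> sets sphere_lebesgue"
      using measurable_sets[OF meas(1) eta] by simp
    have "(\<integral>\<^sup>+u \<in> reverse_radial_gauss_image K \<eta>. ennreal (?g u) \<partial>sphere_lebesgue)
        = (\<integral>\<^sup>+u \<in> ?V. ennreal (?g u) \<partial>sphere_lebesgue)"
      using AE_reverse_radial_gauss_image[OF assms(1) sub] AE_space
      by (intro nn_integral_cong_AE, eventually_elim) (auto simp: indicator_def)
    then have "dual_curvature q K Q \<eta> =
        (\<integral>\<^sup>+u. ennreal (1 / real DIM('a)) * (ennreal (?g u) * indicator ?V u) \<partial>sphere_lebesgue)"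
      unfolding dual_curvature_def by (subst nn_integral_cmult) simp_all
    also have "\<dots> = (\<integral>\<^sup>+u \<in> ?V. ennreal (dual_curvature_density q K Q u) \<partial>sphere_lebesgue)"
      unfolding dual_curvature_density_def
      by (intro nn_integral_cong) (simp add: ennreal_mult'[symmetric] mult.assoc[symmetric])
    also have "\<dots> = emeasure (density sphere_lebesgue (\<lambda>u. ennreal (dual_curvature_density q K Q u))) ?V"
      by (subst emeasure_density) simp_all
    also have "\<dots> = emeasure ?M \<eta>"
      using eta by (subst emeasure_distr) (simp_all)
    finally show ?thesis .
  qed
  have "dual_curvature_measure q K Q = measure_of (space ?S) (sets ?S) (emeasure ?M)"
    unfolding dual_curvature_measure_def
  proof (subst measure_of_eq)
    show "sets ?S \<subseteq> Pow (sphere 0 1)" by (auto simp: sets_restrict_space)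
    fix \<eta> assume "\<eta> \<in> sigma_sets (sphere 0 1) (sets ?S)"
    then have "\<eta> \<in> sets ?S"
      using sets.sigma_sets_eq[of ?S] by (simp add: space_restrict_space)
    then show "dual_curvature q K Q \<eta> = emeasure ?M \<eta>" by (rule dual)
  qed (simp add: space_restrict_space)
  also have "\<dots> = ?M"
    using measure_of_of_measure[of ?M] by simp
  finally show ?thesis .
qed

lemma borel_measurable_support_function:
  fixes K :: "'a::euclidean_space set"
  assumes "K \<in> convex_bodies_o"
  shows "support_function K \<in> borel_measurable (restrict_space borel A)"
  using continuous_on_support_function[OF convex_bodies_oD(1)[OF assms]] convex_bodies_oD(4)[OF assms]
  by (intro borel_measurable_continuous_on_restrict) auto

lemma nn_integral_Lp_dual_curvature_measure:
  fixes K Q :: "'a::euclidean_space set"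
  assumes "K \<in> convex_bodies_o" "Q \<in> star_bodies_o"
    and psi [measurable]: "\<psi> \<in> borel_measurable (restrict_space borel (sphere 0 1))"
  shows "(\<integral>\<^sup>+v. \<psi> v \<partial>Lp_dual_curvature_measure p q K Q) =
    (\<integral>\<^sup>+u. ennreal (dual_curvature_density q K Q u) *
        (ennreal (support_function K (radial_gauss_map K u) powr - p) * \<psi> (radial_gauss_map K u))
      \<partial>sphere_lebesgue)"
proof -
  note [measurable] = measurable_radial_gauss_map[OF assms(1)]
    borel_measurable_sphere_lebesgue[OF continuous_on_dual_curvature_density[OF assms(1,2), of q]]
    borel_measurable_support_function[OF assms(1), of "sphere 0 1"]
  let ?S = "restrict_space borel (sphere 0 1) :: 'a measure"
  let ?D = "density sphere_lebesgue (\<lambda>u. ennreal (dual_curvature_density q K Q u))"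
  let ?h = "\<lambda>v. ennreal (support_function K v powr - p)"
  have h: "?h \<in> borel_measurable ?S" by measurable
  have d: "(\<lambda>u. ennreal (dual_curvature_density q K Q u)) \<in> borel_measurable sphere_lebesgue" by measurable
  have G: "radial_gauss_map K \<in> measurable ?D ?S"
    using measurable_radial_gauss_map[OF assms(1)] by (simp cong: measurable_cong_sets)
  have hpsi: "(\<lambda>v. ?h v * \<psi> v) \<in> borel_measurable ?S" using h psi by (rule borel_measurable_times_ennreal)
  have hpsiG: "(\<lambda>u. ?h (radial_gauss_map K u) * \<psi> (radial_gauss_map K u)) \<in> borel_measurable sphere_lebesgue"
    using measurable_compose[OF measurable_radial_gauss_map[OF assms(1)] hpsi] .
  have "(\<integral>\<^sup>+v. \<psi> v \<partial>Lp_dual_curvature_measure p q K Q)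
      = (\<integral>\<^sup>+v. ?h v * \<psi> v \<partial>distr ?D ?S (radial_gauss_map K))"
    unfolding Lp_dual_curvature_measure_def dual_curvature_measure_eq_distr[OF assms(1,2)]
    by (rule nn_integral_density) (simp_all add: h psi)
  also have "\<dots> = (\<integral>\<^sup>+u. ?h (radial_gauss_map K u) * \<psi> (radial_gauss_map K u) \<partial>?D)"
    by (rule nn_integral_distr[OF G]) (simp add: hpsi)
  also have "\<dots> = (\<integral>\<^sup>+u. ennreal (dual_curvature_density q K Q u) *
        (?h (radial_gauss_map K u) * \<psi> (radial_gauss_map K u)) \<partial>sphere_lebesgue)"
    by (rule nn_integral_density[OF d hpsiG])
  finally show ?thesis .
qed

section \<open>Comparison of two bodies\<close>

text \<open>
  Let \<open>v\<close> be a normal of \<open>K\<close> at \<open>u\<close>. Then \<open>support_function K v = radial_function K u * (u \<bullet> v)\<close>,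
  while for \<open>L\<close> only \<open>\<ge>\<close> holds; divide. With the bodies exchanged, this bounds the radial
  ratio from above by the support ratio at a normal of \<open>L\<close>.
\<close>

lemma support_ratio_le_radial_ratio:
  fixes K L :: "'a::euclidean_space set"
  assumes "K \<in> convex_bodies_o" "L \<in> convex_bodies_o" "u \<in> sphere 0 1"
  shows "support_function K (radial_gauss_map K u) / support_function L (radial_gauss_map K u)
           \<le> radial_function K u / radial_function L u"
proof -
  define v where "v = radial_gauss_map K u"
  note v = radial_gauss_map[OF assms(1,3), folded v_def]
  have "0 < support_function L v"
    using support_function_pos[OF convex_bodies_oD(1,3)[OF assms(2)] v(1)] .
  moreover have "0 < support_function K v"
    using support_function_pos[OF convex_bodies_oD(1,3)[OF assms(1)] v(1)] .
  moreover note rK = radial_function_pos_bodies(1)[OF assms(1,3)]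
  moreover note rL = radial_function_pos_bodies(1)[OF assms(2,3)]
  moreover have "radial_function L u * (u \<bullet> v) \<le> support_function L v"
    using radial_inner_le_support[OF convex_bodies_oD(1,4)[OF assms(2)] assms(3)] .
  then have "radial_function K u * (radial_function L u * (u \<bullet> v)) \<le> radial_function K u * support_function L v"
    using rK by simp
  then have "support_function K v * radial_function L u \<le> radial_function K u * support_function L v"
    unfolding v(2)[symmetric] by (simp add: mult_ac)
  ultimately show ?thesis
    unfolding v_def[symmetric] by (simp add: divide_simps)
qed

lemma powr_mult_le_powr_add:
  fixes a g b s q :: real
  assumes "1 < a" "a \<le> g" "g \<le> b" "0 \<le> s" "0 \<le> s + q"
  shows "a powr s * g powr q \<le> b powr (s + q)"
proof -
  have "a powr s * g powr q \<le> g powr s * g powr q"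
    using assms by (intro mult_right_mono powr_mono2) auto
  also have "\<dots> = g powr (s + q)" by (simp add: powr_add)
  also have "\<dots> \<le> b powr (s + q)"
    using assms by (intro powr_mono2) auto
  finally show ?thesis .
qed

lemma dual_curvature_density_ratio:
  assumes "K \<in> convex_bodies_o" "L \<in> convex_bodies_o" "u \<in> sphere 0 1"
  shows "dual_curvature_density q K Q u = (radial_function K u / radial_function L u) powr q * dual_curvature_density q L Q u"
  using radial_function_pos_bodies(1)[OF assms(1,3)] radial_function_pos_bodies(1)[OF assms(2,3)]
  by (simp add: dual_curvature_density_def powr_divide)

text \<open>
  The argument outlined at the top, with the test function \<open>\<psi>\<close> equal to
  \<open>f powr s * support_function K powr p\<close> on \<open>{f > 1}\<close> and zero elsewhere. The factor
  \<open>support_function K powr p\<close> cancels the weight of the measure of \<open>K\<close>; against the measure of \<open>L\<close>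
  it leaves \<open>f powr p\<close>.
\<close>

lemma radial_function_le_if_Lp_dual_curvature_measure_eq:
  fixes K L Q :: "'a::euclidean_space set"
  assumes "q < p" "Q \<in> star_bodies_o" "K \<in> convex_bodies_o" "L \<in> convex_bodies_o"
    and eq: "Lp_dual_curvature_measure p q K Q = Lp_dual_curvature_measure p q L Q"
    and u: "u \<in> sphere 0 1"
  shows "radial_function K u \<le> radial_function L u"
proof -
  \<comment> \<open>Both \<open>s\<close> and \<open>s + q\<close> must be nonnegative, so that the powers in the comparison are increasing.\<close>
  define s where "s = \<bar>q\<bar>"
  have s: "0 \<le> s" "0 \<le> s + q" by (auto simp: s_def)
  define f where "f v = support_function K v / support_function L v" for v
  define g where "g u = radial_function K u / radial_function L u" for u
  define a where "a u = f (radial_gauss_map K u)" for u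
  define b where "b u = f (radial_gauss_map L u)" for u
  define c where "c u = dual_curvature_density q L Q u" for u
  define \<psi> where "\<psi> v = ennreal (if 1 < f v then f v powr s * support_function K v powr p else 0)" for v
  have hK: "0 < support_function K v" if "v \<in> sphere 0 1" for v
    using support_function_pos[OF convex_bodies_oD(1,3)[OF assms(3)] that] .
  have hL: "0 < support_function L v" if "v \<in> sphere 0 1" for v
    using support_function_pos[OF convex_bodies_oD(1,3)[OF assms(4)] that] .
  have f_pos: "0 < f v" if "v \<in> sphere 0 1" for v
    using hK[OF that] hL[OF that] by (simp add: f_def)
  have c_pos: "0 < c u" if "u \<in> sphere 0 1" for u
    using dual_curvature_density_pos[OF assms(4,2) that] by (simp add: c_def)
  have ag: "a u \<le> g u" if "u \<in> sphere 0 1" for u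
    using support_ratio_le_radial_ratio[OF assms(3,4) that] by (simp add: a_def f_def g_def)
  have gb: "g u \<le> b u" if "u \<in> sphere 0 1" for u
  proof -
    have "1 / b u \<le> 1 / g u"
      using support_ratio_le_radial_ratio[OF assms(4,3) that] by (simp add: b_def f_def g_def)
    moreover have "0 < b u" "0 < g u"
      using f_pos radial_gauss_map(1)[OF assms(4) that] radial_function_pos_bodies(1)[OF assms(3) that]
        radial_function_pos_bodies(1)[OF assms(4) that] by (auto simp: b_def g_def)
    ultimately show ?thesis by (simp add: divide_simps)
  qed
  note [measurable] = borel_measurable_support_function[OF assms(3), of "sphere 0 1"]
    borel_measurable_support_function[OF assms(4), of "sphere 0 1"]
    measurable_radial_gauss_map[OF assms(4)]
  have f_meas [measurable]: "f \<in> borel_measurable (restrict_space borel (sphere 0 1))"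
    unfolding f_def by measurable
  have \<psi> [measurable]: "\<psi> \<in> borel_measurable (restrict_space borel (sphere 0 1))"
    unfolding \<psi>_def by measurable
  have b_meas [measurable]: "b \<in> borel_measurable sphere_lebesgue"
    unfolding b_def by measurable
  have c_meas [measurable]: "c \<in> borel_measurable sphere_lebesgue"
    unfolding c_def by (rule borel_measurable_sphere_lebesgue[OF continuous_on_dual_curvature_density[OF assms(4,2)]])
  define J where "J r u = ennreal (if 1 < b u then b u powr r * c u else 0)" for r u
  have J_meas [measurable]: "J r \<in> borel_measurable sphere_lebesgue" for r
    unfolding J_def by measurable
  have "(\<integral>\<^sup>+u. J (s + p) u \<partial>sphere_lebesgue) = (\<integral>\<^sup>+v. \<psi> v \<partial>Lp_dual_curvature_measure p q L Q)"
    unfolding nn_integral_Lp_dual_curvature_measure[OF assms(4,2) \<psi>]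
  proof (rule nn_integral_cong)
    fix u assume "u \<in> space (sphere_lebesgue :: 'a measure)"
    then have v: "radial_gauss_map L u \<in> sphere 0 1" (is "?v \<in> _") and u: "u \<in> sphere 0 1"
      using radial_gauss_map(1)[OF assms(4)] by simp_all
    have "f ?v powr p = support_function K ?v powr p * support_function L ?v powr - p"
      using hK[OF v] hL[OF v] by (simp add: f_def powr_divide powr_minus_divide)
    then show "J (s + p) u = ennreal (dual_curvature_density q L Q u) *
        (ennreal (support_function L ?v powr - p) * \<psi> ?v)"
      using c_pos[OF u]
      by (simp add: J_def \<psi>_def b_def c_def powr_add ennreal_mult'[symmetric] mult_ac)
  qed
  also have "\<dots> = (\<integral>\<^sup>+v. \<psi> v \<partial>Lp_dual_curvature_measure p q K Q)"
    by (simp add: eq)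
  also have "\<dots> \<le> (\<integral>\<^sup>+u. J (s + q) u \<partial>sphere_lebesgue)"
    unfolding nn_integral_Lp_dual_curvature_measure[OF assms(3,2) \<psi>]
  proof (rule nn_integral_mono)
    fix u assume "u \<in> space (sphere_lebesgue :: 'a measure)"
    then have v: "radial_gauss_map K u \<in> sphere 0 1" (is "?v \<in> _") and u: "u \<in> sphere 0 1"
      using radial_gauss_map(1)[OF assms(3)] by simp_all
    have K: "dual_curvature_density q K Q u = g u powr q * c u"
      using dual_curvature_density_ratio[OF assms(3,4) u] by (simp add: g_def c_def)
    show "ennreal (dual_curvature_density q K Q u) * (ennreal (support_function K ?v powr - p) * \<psi> ?v) \<le> J (s + q) u"
    proof (cases "1 < a u")
      case True
      then have "1 < b u" using ag[OF u] gb[OF u] by simp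
      have "support_function K ?v powr - p * support_function K ?v powr p = 1"
        using hK[OF v] by (simp add: powr_add[symmetric])
      then have "dual_curvature_density q K Q u * (support_function K ?v powr - p *
          (a u powr s * support_function K ?v powr p)) = a u powr s * g u powr q * c u"
        unfolding K by (simp add: mult_ac)
      also have "\<dots> \<le> b u powr (s + q) * c u"
        using powr_mult_le_powr_add[OF True ag[OF u] gb[OF u] s] c_pos[OF u] by (intro mult_right_mono) auto
      finally show ?thesis
        using True \<open>1 < b u\<close> less_imp_le[OF dual_curvature_density_pos[OF assms(3,2) u, of q]]
        by (simp add: J_def \<psi>_def a_def ennreal_mult'[symmetric] ennreal_leI)
    next
      case False
      then show ?thesis by (simp add: \<psi>_def a_def)
    qed
  qed
  finally have le: "(\<integral>\<^sup>+u. J (s + p) u \<partial>sphere_lebesgue) \<le> (\<integral>\<^sup>+u. J (s + q) u \<partial>sphere_lebesgue)" .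
  have finite: "(\<integral>\<^sup>+u. J (s + q) u \<partial>sphere_lebesgue) \<noteq> \<infinity>"
  proof -
    have cont: "continuous_on (sphere 0 1) f"
      unfolding f_def using hL convex_bodies_oD(1,4)[OF assms(3)] convex_bodies_oD(1,4)[OF assms(4)]
      by (intro continuous_intros continuous_on_support_function) force+
    have "bdd_above (f ` sphere 0 1)"
      by (intro bounded_imp_bdd_above compact_imp_bounded compact_continuous_image cont compact_sphere)
    then obtain B where B: "\<And>v. v \<in> sphere 0 1 \<Longrightarrow> f v \<le> B"
      unfolding bdd_above_def by blast
    have "bdd_above (c ` sphere 0 1)"
      unfolding c_def by (intro bounded_imp_bdd_above compact_imp_bounded compact_continuous_image
          continuous_on_dual_curvature_density assms compact_sphere)
    then obtain C where C: "\<And>u. u \<in> sphere 0 1 \<Longrightarrow> c u \<le> C"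
      unfolding bdd_above_def by blast
    have "J (s + q) u \<le> ennreal (B powr (s + q) * C)" if u: "u \<in> sphere 0 1" for u
    proof (cases "1 < b u")
      case True
      have "b u \<le> B" using B radial_gauss_map(1)[OF assms(4) u] by (simp add: b_def)
      then have "b u powr (s + q) * c u \<le> B powr (s + q) * C"
        using True C[OF u] c_pos[OF u] s by (intro mult_mono powr_mono2) auto
      then show ?thesis using True by (simp add: J_def ennreal_leI)
    qed (simp add: J_def)
    then have "(\<integral>\<^sup>+u. J (s + q) u \<partial>sphere_lebesgue)
        \<le> (\<integral>\<^sup>+u. ennreal (B powr (s + q) * C) \<partial>(sphere_lebesgue :: 'a measure))"
      by (intro nn_integral_mono) simp
    also have "\<dots> < \<infinity>"
      using emeasure_sphere_lebesgue_finite[where 'a = 'a] by (simp add: ennreal_mult_less_top)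
    finally show ?thesis by simp
  qed
  \<comment> \<open>On \<open>{b > 1}\<close> the larger exponent gives the strictly larger integrand, so the set is null.\<close>
  have powr_less: "b u powr (s + q) * c u < b u powr (s + p) * c u" if "u \<in> sphere 0 1" "1 < b u" for u
    using that c_pos[OF that(1)] \<open>q < p\<close> by (simp add: powr_less_cancel_iff)
  have "AE u in sphere_lebesgue. J (s + p) u \<le> J (s + q) u"
  proof (rule ccontr)
    assume "\<not> (AE u in sphere_lebesgue. J (s + p) u \<le> J (s + q) u)"
    moreover have "AE u in sphere_lebesgue. J (s + q) u \<le> J (s + p) u"
      using AE_space by eventually_elim (auto simp: J_def intro!: ennreal_leI less_imp_le[OF powr_less])
    ultimately have "(\<integral>\<^sup>+u. J (s + q) u \<partial>sphere_lebesgue) < (\<integral>\<^sup>+u. J (s + p) u \<partial>sphere_lebesgue)"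
      using finite by (intro nn_integral_less) auto
    with le show False by simp
  qed
  then have "AE u in sphere_lebesgue. radial_function K u - radial_function L u \<le> 0"
    using AE_space
  proof eventually_elim
    case (elim u)
    then have u: "u \<in> sphere 0 1" by simp
    have "\<not> 1 < b u"
    proof
      assume "1 < b u"
      then have "b u powr (s + p) * c u \<le> b u powr (s + q) * c u"
        using elim(1) c_pos[OF u] by (simp add: J_def ennreal_le_iff)
      with powr_less[OF u \<open>1 < b u\<close>] show False by simp
    qed
    then have "g u \<le> 1" using gb[OF u] by simp
    then show ?case
      using radial_function_pos_bodies(1)[OF assms(4) u] by (simp add: g_def divide_le_eq_1_pos)
  qed
  then have "radial_function K u - radial_function L u \<le> 0"
    by (intro AE_sphere_lebesgue_le_0_imp_le_0[OF _ _ u] continuous_intros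
        continuous_on_radial_function_bodies(1) assms)
  then show ?thesis by simp
qed

lemma subset_if_radial_function_le:
  fixes K L :: "'a::euclidean_space set"
  assumes "compact K" "0 \<in> K" "compact L" "convex L" "0 \<in> L"
    and "\<And>u. u \<in> sphere 0 1 \<Longrightarrow> radial_function K u \<le> radial_function L u"
  shows "K \<subseteq> L"
proof
  fix x assume "x \<in> K"
  show "x \<in> L"
  proof (cases "x = 0")
    case False
    then have u: "norm (sgn x) = 1" and x: "x = norm x *\<^sub>R sgn x"
      by (simp_all add: norm_sgn sgn_div_norm)
    define t where "t = norm x / radial_function L (sgn x)"
    have "norm x \<le> radial_function K (sgn x)"
      using radial_function_is_max(3)[OF assms(1,2) u, of "norm x"] \<open>x \<in> K\<close> x by simp
    also have "\<dots> \<le> radial_function L (sgn x)" using assms(6) u by simp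
    finally have le: "norm x \<le> radial_function L (sgn x)" .
    then have pos: "0 < radial_function L (sgn x)"
      using False by (meson less_le_trans zero_less_norm_iff)
    have t: "0 \<le> t" "0 \<le> 1 - t" "t + (1 - t) = 1"
      using le pos by (simp_all add: t_def)
    have "radial_function L (sgn x) *\<^sub>R sgn x \<in> L"
      by (rule radial_function_is_max(2)[OF assms(3,5) u])
    then have "t *\<^sub>R (radial_function L (sgn x) *\<^sub>R sgn x) + (1 - t) *\<^sub>R 0 \<in> L"
      by (rule convexD[OF assms(4) _ assms(5) t])
    then show ?thesis using x pos by (simp add: t_def)
  qed (use assms in simp)
qed

theorem theorem1p1:
  fixes p q :: real
    and K L Q :: "(real ^ 'n) set"
  assumes "q < p"
    and "Q \<in> star_bodies_o"
    and "K \<in> convex_bodies_o"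
    and "L \<in> convex_bodies_o"
    and "Lp_dual_curvature_measure p q K Q = Lp_dual_curvature_measure p q L Q"
  shows "K = L"
proof
  show "K \<subseteq> L"
    by (rule subset_if_radial_function_le[OF convex_bodies_oD(1,4)[OF assms(3)]
        convex_bodies_oD(1,2,4)[OF assms(4)] radial_function_le_if_Lp_dual_curvature_measure_eq[OF assms]])
  show "L \<subseteq> K"
    by (rule subset_if_radial_function_le[OF convex_bodies_oD(1,4)[OF assms(4)]
        convex_bodies_oD(1,2,4)[OF assms(3)] radial_function_le_if_Lp_dual_curvature_measure_eq[OF assms(1,2,4,3) assms(5)[symmetric]]])
qed

end
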